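(* Let $\mathbf{A}$ be a finite relational structure of coverwidth $\leq k$ (where $k\ge 1$), and let $\mathbf{B}$ be an arbitrary finite relational structure over the same signature. There is a winning strategy for the Duplicator in the existential $k$-cover game on $\mathbf{A}, \mathbf{B}$ if and only if there is a homomorphism from $\mathbf{A}$ to $\mathbf{B}$.
   Context: A relational structure $\mathbf{A}$ over a finite relational signature has a finite universe $A$ and a relation $R^{\mathbf{A}}\subseteq A^r$ for each symbol $R$ of arity $r$; a homomorphism $\mathbf{A}\to\mathbf{B}$ is a map $h:A\to B$ sending tuples of each $R^{\mathbf{A}}$ into $R^{\mathbf{B}}$. $H(\mathbf{A})$ is the hypergraph on $A$ with a hyperedge $\{a_1,\ldots,a_r\}$ for each tuple in any relation of $\mathbf{A}$. A $k$-union is a union of $k$ hyperedges (the empty set being the $0$-union). The weight of $X\subseteq A$ is the least $k\ge0$ such that $X\cap\bigcup_{e}e$ is contained in a $k$-union. A tree decomposition of $H(\mathbf{A})$ is a tree with bags $X_i\subseteq A$ covering $A$, each hyperedge contained in some bag, and for each vertex the bags containing it forming a connected subtree; its weight is the maximum bag weight; the coverwidth of $\mathbf{A}$ is the minimum weight of a tree decomposition of $H(\mathbf{A})$. A projective homomorphism from $\mathbf{A}$ to $\mathbf{B}$ is a partial function $h:A\rightharpoonup B$ such that for every $R$ and every $(a_1,\ldots,a_r)\in R^{\mathbf{A}}$ there is $(b_1,\ldots,b_r)\in R^{\mathbf{B}}$ with $h(a_i)=b_i$ whenever $a_i\in\mathsf{dom}(h)$. A winning strategy for the Duplicator in the existential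 $k$-cover game on $\mathbf{A},\mathbf{B}$ is a non-empty set $H$ of projective homomorphisms from $\mathbf{A}$ to $\mathbf{B}$ closed under restriction to subdomains and such that for every $h\in H$ and $a\notin\mathsf{dom}(h)$ with $\mathsf{dom}(h)\cup\{a\}$ of weight $\le k$, some $h'\in H$ extends $h$ with $\mathsf{dom}(h')=\mathsf{dom}(h)\cup\{a\}$. *)

theory Defs
  imports "Graph_Theory.Graph_Theory"
begin

record 'r signature =
  symbols :: "'r set"
  arity :: "'r \<Rightarrow> nat"

record ('r, 'a) rel_structure =
  univ :: "'a set"
  rel :: "'r \<Rightarrow> 'a list set"

text \<open>The empty universe and nullary relation symbols are allowed. What a structure assigns to
  elements of the type of symbols outside \<open>symbols \<sigma>\<close> is irrelevant.\<close>

definition finite_structure :: "'r signature \<Rightarrow> ('r, 'a) rel_structure \<Rightarrow> bool" where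
  "finite_structure \<sigma> A \<longleftrightarrow> finite (univ A) \<and>
     (\<forall>R \<in> symbols \<sigma>. rel A R \<subseteq> {t. length t = arity \<sigma> R \<and> set t \<subseteq> univ A})"

definition homomorphism ::
    "'r signature \<Rightarrow> ('r, 'a) rel_structure \<Rightarrow> ('r, 'b) rel_structure \<Rightarrow> ('a \<Rightarrow> 'b) \<Rightarrow> bool" where
  "homomorphism \<sigma> A B h \<longleftrightarrow> h \<in> univ A \<rightarrow> univ B \<and>
     (\<forall>R \<in> symbols \<sigma>. \<forall>t \<in> rel A R. map h t \<in> rel B R)"

definition hyperedges :: "'r signature \<Rightarrow> ('r, 'a) rel_structure \<Rightarrow> 'a set set" where
  "hyperedges \<sigma> A = {set t | t R. R \<in> symbols \<sigma> \<and> t \<in> rel A R}"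

definition k_union :: "'r signature \<Rightarrow> ('r, 'a) rel_structure \<Rightarrow> nat \<Rightarrow> 'a set \<Rightarrow> bool" where
  "k_union \<sigma> A k U \<longleftrightarrow>
     (\<exists>F. F \<subseteq> hyperedges \<sigma> A \<and> finite F \<and> card F = k \<and> U = \<Union>F)"

definition weight :: "'r signature \<Rightarrow> ('r, 'a) rel_structure \<Rightarrow> 'a set \<Rightarrow> nat" where
  "weight \<sigma> A X = (LEAST k. \<exists>U. k_union \<sigma> A k U \<and> X \<inter> \<Union>(hyperedges \<sigma> A) \<subseteq> U)"

text \<open>The library constant \<^const>\<open>tree\<close> forbids directed cycles only: it holds of
  digraphs whose underlying graph has a cycle, and fails for every symmetric digraph with an arc,
  where going back and forth along an edge is a cycle of length 2. An undirected tree is therefore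
  a connected simple graph (\<^const>\<open>pair_graph\<close>: finite, symmetric, loop-free) without cycles of
  length at least 3. Connectedness includes having a vertex.\<close>

definition undirected_tree :: "'t pair_pre_digraph \<Rightarrow> bool" where
  "undirected_tree T \<longleftrightarrow> pair_graph T \<and> connected (with_proj T) \<and>
     \<not> (\<exists>p. pre_digraph.cycle (with_proj T) p \<and> length p \<ge> 3)"

definition tree_decomposition ::
    "'r signature \<Rightarrow> ('r, 'a) rel_structure \<Rightarrow> 't pair_pre_digraph \<Rightarrow> ('t \<Rightarrow> 'a set) \<Rightarrow> bool" where
  "tree_decomposition \<sigma> A T X \<longleftrightarrow> undirected_tree T \<and>
     (\<Union>i \<in> pverts T. X i) = univ A \<and>
     (\<forall>e \<in> hyperedges \<sigma> A. \<exists>i \<in> pverts T. e \<subseteq> X i) \<and>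
     (\<forall>a \<in> univ A. connected (with_proj T \<restriction> {i \<in> pverts T. a \<in> X i}))"

definition decomposition_weight ::
    "'r signature \<Rightarrow> ('r, 'a) rel_structure \<Rightarrow> 't pair_pre_digraph \<Rightarrow> ('t \<Rightarrow> 'a set) \<Rightarrow> nat" where
  "decomposition_weight \<sigma> A T X = Max ((\<lambda>i. weight \<sigma> A (X i)) ` pverts T)"

text \<open>Trees being finite, it is enough to range over those whose nodes are natural numbers.\<close>

definition coverwidth :: "'r signature \<Rightarrow> ('r, 'a) rel_structure \<Rightarrow> nat" where
  "coverwidth \<sigma> A = (LEAST w. \<exists>(T :: nat pair_pre_digraph) X.
     tree_decomposition \<sigma> A T X \<and> decomposition_weight \<sigma> A T X = w)"

definition projective_homomorphism ::
    "'r signature \<Rightarrow> ('r, 'a) rel_structure \<Rightarrow> ('r, 'b) rel_structure \<Rightarrow> ('a \<rightharpoonup> 'b) \<Rightarrow> bool" where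
  "projective_homomorphism \<sigma> A B h \<longleftrightarrow> dom h \<subseteq> univ A \<and> ran h \<subseteq> univ B \<and>
     (\<forall>R \<in> symbols \<sigma>. \<forall>s \<in> rel A R. \<exists>t \<in> rel B R.
        \<forall>i < length s. s ! i \<in> dom h \<longrightarrow> h (s ! i) = Some (t ! i))"

definition winning_strategy ::
    "'r signature \<Rightarrow> nat \<Rightarrow> ('r, 'a) rel_structure \<Rightarrow> ('r, 'b) rel_structure \<Rightarrow> ('a \<rightharpoonup> 'b) set \<Rightarrow> bool"
  where
  "winning_strategy \<sigma> k A B H \<longleftrightarrow> H \<noteq> {} \<and>
     (\<forall>h \<in> H. projective_homomorphism \<sigma> A B h) \<and>
     (\<forall>h \<in> H. \<forall>S \<subseteq> dom h. h |` S \<in> H) \<and>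
     (\<forall>h \<in> H. \<forall>a \<in> univ A - dom h. weight \<sigma> A (dom h \<union> {a}) \<le> k \<longrightarrow>
        (\<exists>h' \<in> H. h \<subseteq>\<^sub>m h' \<and> dom h' = dom h \<union> {a}))"

end

theory Submission
  imports Defs
begin

text \<open>A strategy contains total assignments on every bag of a tree decomposition of weight at most
  \<open>k\<close>, because all subsets of a bag have weight at most \<open>k\<close>. Exploring the tree from a root, the
  assignment on a new bag is chosen to extend the restriction of the assignment on the
  neighbouring, already explored bag. By the connectedness condition, the new bag meets the explored
  ones inside that neighbour, so the assignments glue to a single map on the universe; it is a
  homomorphism since each hyperedge lies in a bag.\<close>

section \<open>Trees\<close>

lemma pair_graph_sym_parcs: "pair_graph T \<Longrightarrow> sym (parcs T)"
  by (simp add: pair_graph_def pair_pseudo_graph_def pair_sym_digraph_def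
      pair_sym_digraph_axioms_def symmetric_def)

text \<open>\<open>connected\<close> means strong connectedness of the symmetric closure. With
  \<open>parcs T\<close> already symmetric, that closure adds no arcs, so connectedness becomes
  plain reachability along arcs inside \<open>C\<close>.\<close>

lemma connected_restrict_rtrancl:
  assumes "sym (parcs T)" and "connected (with_proj T \<restriction> C)" and "i \<in> C" and "j \<in> C"
  shows "(i, j) \<in> (parcs T \<inter> C \<times> C)\<^sup>*"
proof -
  let ?M = "with_proj (mk_symmetric (with_proj T \<restriction> C))"
  have "arcs_ends ?M \<subseteq> parcs T \<inter> C \<times> C"
    using assms(1) by (auto simp: mk_symmetric_def induce_subgraph_def dest: symD)
  moreover have "i \<rightarrow>\<^sup>*\<^bsub>?M\<^esub> j"
    using assms(2-4) unfolding connected_def strongly_connected_def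
    by (auto simp: mk_symmetric_def induce_subgraph_def)
  then have "(i, j) \<in> (arcs_ends ?M)\<^sup>*"
    unfolding reachable_def by (rule rtrancl_on_rtranclI)
  ultimately show ?thesis
    using rtrancl_mono by blast
qed

lemma undirected_tree_rtrancl:
  assumes "undirected_tree T" and "i \<in> pverts T" and "j \<in> pverts T"
  shows "(i, j) \<in> (parcs T)\<^sup>*"
proof -
  let ?M = "with_proj (mk_symmetric (with_proj T))"
  have "sym (parcs T)"
    using assms(1) by (simp add: undirected_tree_def pair_graph_sym_parcs)
  then have "arcs_ends ?M \<subseteq> parcs T"
    by (auto simp: mk_symmetric_def dest: symD)
  moreover have "i \<rightarrow>\<^sup>*\<^bsub>?M\<^esub> j"
    using assms unfolding undirected_tree_def connected_def strongly_connected_def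
    by (auto simp: mk_symmetric_def)
  then have "(i, j) \<in> (arcs_ends ?M)\<^sup>*"
    unfolding reachable_def by (rule rtrancl_on_rtranclI)
  ultimately show ?thesis
    using rtrancl_mono by blast
qed

text \<open>A walk from \<open>u\<close> to \<open>v\<close> avoiding the edge could be shortened to
  a path, which the arc from \<open>v\<close> to \<open>u\<close> would close to a cycle of length
  at least 3.\<close>

lemma undirected_tree_arc_is_bridge:
  assumes tree: "undirected_tree T" and arc: "(u, v) \<in> parcs T"
  shows "(u, v) \<notin> (parcs T - {(u, v), (v, u)})\<^sup>*"
proof
  assume walk: "(u, v) \<in> (parcs T - {(u, v), (v, u)})\<^sup>*"
  interpret T: pair_graph T
    using tree by (simp add: undirected_tree_def)
  \<comment> \<open>Deleting the edge in both directions leaves a digraph, so reachability in it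
    yields a path with distinct vertices.\<close>
  define D where "D = \<lparr>pverts = pverts T, parcs = parcs T - {(u, v), (v, u)}\<rparr>"
  interpret D: pair_wf_digraph D
    by unfold_locales (auto simp: D_def dest: T.in_arcsD1 T.in_arcsD2)
  have "(u, v) \<in> rtrancl_on (pverts D) (parcs D)"
    using walk
  proof (induction rule: rtrancl_induct)
    case base
    then show ?case using arc by (auto simp: D_def dest: T.in_arcsD1)
  next
    case (step y z)
    then show ?case
      by (auto simp: D_def intro: rtrancl_on_into_rtrancl_on dest: T.in_arcsD2)
  qed
  then have "u \<rightarrow>\<^sup>*\<^bsub>with_proj D\<^esub> v"
    by (simp add: reachable_def)
  then obtain p where p: "D.apath u p v"
    using D.reachable_apath by blast
  then have walkD: "D.awalk u p v" and dist: "distinct (pawalk_verts u p)"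
    by (auto simp: D.apath_def)
  have "subgraph (with_proj D) (with_proj T)"
    unfolding subgraph_def
    by (auto simp: D_def[symmetric] T.wf_digraph_axioms D.wf_digraph_axioms) (auto simp: D_def)
  then have walkT: "T.awalk u p v"
    using T.subgraph_awalk_imp_awalk walkD by blast
  have vu: "(v, u) \<in> parcs T"
    using pair_graph_sym_parcs[OF T.pair_graph_axioms] arc by (auto dest: symD)
  have "u \<noteq> v"
    using T.pair_no_loops[OF arc] by simp
  have arcs: "set p \<subseteq> parcs D"
    using walkD by (auto simp: D.awalk_def)
  \<comment> \<open>The empty path would force \<open>u = v\<close>, and a single arc would be the
    deleted one. Two arcs are just enough to rule out the harmless cycle of going back and
    forth.\<close>
  have "length p \<ge> 2"
  proof (rule ccontr)
    assume "\<not> length p \<ge> 2"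
    then consider "p = []" | a where "p = [a]"
      by (cases p) (auto simp: Suc_le_eq)
    then show False
    proof cases
      case 1
      then show False using walkD \<open>u \<noteq> v\<close> by (auto simp: D.awalk_def)
    next
      case 2
      then have "a = (u, v)"
        using walkD by (cases a) (simp add: D.awalk_Cons_iff D.awalk_Nil_iff)
      then show False using arcs 2 by (simp add: D_def)
    qed
  qed
  have "T.awalk v ((v, u) # p) v"
    using walkT vu by (simp add: T.awalk_Cons_iff)
  \<comment> \<open>Based at \<open>v\<close>, the closed walk visits after its first vertex exactly
    the vertices of \<open>p\<close>, which are distinct.\<close>
  then have "T.cycle ((v, u) # p)"
    using dist unfolding T.cycle_def by (intro exI[of _ v]) simp
  moreover have "length ((v, u) # p) \<ge> 3"
    using \<open>length p \<ge> 2\<close> by simp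
  ultimately show False
    using tree unfolding undirected_tree_def by blast
qed

text \<open>If \<open>u\<close> were outside \<open>C\<close>, going from \<open>u\<close> to
  \<open>i\<close> inside \<open>S\<close> and from \<open>i\<close> back to \<open>v\<close> inside
  \<open>C\<close> would avoid the edge between \<open>u\<close> and \<open>v\<close>, which is a
  bridge. In the application \<open>S\<close> is the explored part and \<open>C\<close> the set of
  nodes whose bags contain a given vertex.\<close>

lemma undirected_tree_separation:
  assumes tree: "undirected_tree T" and uv: "(u, v) \<in> parcs T"
    and "(u, i) \<in> (parcs T \<inter> S \<times> S)\<^sup>*" and "v \<notin> S"
    and "(v, i) \<in> (parcs T \<inter> C \<times> C)\<^sup>*"
  shows "u \<in> C"
proof (rule ccontr)
  assume "u \<notin> C"
  let ?E = "parcs T - {(u, v), (v, u)}"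
  have "sym (parcs T)"
    using tree by (simp add: undirected_tree_def pair_graph_sym_parcs)
  \<comment> \<open>Symmetry survives because both directions are deleted; it allows the walk from
    \<open>v\<close> to \<open>i\<close> to be reversed.\<close>
  then have "sym (?E\<^sup>*)"
    by (intro sym_rtrancl) (auto simp: sym_def)
  have "parcs T \<inter> S \<times> S \<subseteq> ?E" "parcs T \<inter> C \<times> C \<subseteq> ?E"
    using \<open>v \<notin> S\<close> \<open>u \<notin> C\<close> by auto
  then have "(u, i) \<in> ?E\<^sup>*" "(v, i) \<in> ?E\<^sup>*"
    using assms(3,5) rtrancl_mono by blast+
  then have "(u, v) \<in> ?E\<^sup>*"
    using \<open>sym (?E\<^sup>*)\<close> by (meson rtrancl_trans symD)
  then show False
    using undirected_tree_arc_is_bridge[OF tree uv] by simp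
qed

text \<open>Exploration of the tree node by node. The step case provides the separation property
  that gluing needs: a connected set joining the new node \<open>v\<close> to the explored part must
  pass through the neighbour \<open>u\<close>.\<close>

lemma undirected_tree_induct [consumes 1, case_names root step]:
  assumes tree: "undirected_tree T"
    and root: "\<And>r. r \<in> pverts T \<Longrightarrow> P {r}"
    and step: "\<And>S u v. S \<subseteq> pverts T \<Longrightarrow> u \<in> S \<Longrightarrow> v \<in> pverts T - S \<Longrightarrow>
      (\<And>C i. i \<in> S \<Longrightarrow> (v, i) \<in> (parcs T \<inter> C \<times> C)\<^sup>* \<Longrightarrow> u \<in> C) \<Longrightarrow> P S \<Longrightarrow> P (insert v S)"
  shows "P (pverts T)"
proof -
  interpret T: pair_graph T
    using tree by (simp add: undirected_tree_def)
  \<comment> \<open>Besides \<open>P\<close>, the explored part must be connected within itself, as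
    separation needs a walk from \<open>u\<close> to \<open>i\<close> avoiding \<open>v\<close>. A
    set of maximal cardinality with this property will be all of \<open>pverts T\<close>.\<close>
  define Q where "Q S \<longleftrightarrow> S \<subseteq> pverts T \<and> S \<noteq> {} \<and> P S \<and>
    (\<forall>i \<in> S. \<forall>j \<in> S. (i, j) \<in> (parcs T \<inter> S \<times> S)\<^sup>*)" for S
  obtain r where "r \<in> pverts T"
    using tree unfolding undirected_tree_def connected_def strongly_connected_def
    by (auto simp: mk_symmetric_def)
  then have "Q {r}"
    using root by (auto simp: Q_def)
  moreover have "\<forall>S. Q S \<longrightarrow> card S < Suc (card (pverts T))"
    using T.pair_finite_verts by (auto simp: Q_def less_Suc_eq_le intro: card_mono)
  ultimately obtain S where QS: "Q S" and max: "\<forall>S'. Q S' \<longrightarrow> card S' \<le> card S"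
    using ex_has_greatest_nat[of Q "{r}" card "Suc (card (pverts T))"] by blast
  then have Q: "S \<subseteq> pverts T" "S \<noteq> {}" "P S"
      "\<And>i j. i \<in> S \<Longrightarrow> j \<in> S \<Longrightarrow> (i, j) \<in> (parcs T \<inter> S \<times> S)\<^sup>*"
    by (auto simp: Q_def)
  have "S = pverts T"
  proof (rule ccontr)
    assume "S \<noteq> pverts T"
    then obtain s w where "s \<in> S" "w \<in> pverts T" "w \<notin> S"
      using Q(1,2) by blast
    then have "(s, w) \<in> (parcs T)\<^sup>*"
      using undirected_tree_rtrancl[OF tree] Q(1) by blast
    \<comment> \<open>A walk from inside \<open>S\<close> to outside crosses its boundary along some
      arc.\<close>
    then have "\<exists>u v. u \<in> S \<and> v \<notin> S \<and> (u, v) \<in> parcs T"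
      using \<open>s \<in> S\<close> \<open>w \<notin> S\<close> by (induction rule: rtrancl_induct) blast+
    then obtain u v where u: "u \<in> S" and v: "v \<notin> S" and uv: "(u, v) \<in> parcs T"
      by blast
    have vu: "(v, u) \<in> parcs T"
      using pair_graph_sym_parcs[OF T.pair_graph_axioms] uv by (auto dest: symD)
    have vV: "v \<in> pverts T"
      using uv by (rule T.in_arcsD2)
    let ?S = "insert v S"
    let ?E = "parcs T \<inter> ?S \<times> ?S"
    have "u \<in> C" if "i \<in> S" "(v, i) \<in> (parcs T \<inter> C \<times> C)\<^sup>*" for C i
      using undirected_tree_separation[OF tree uv Q(4)[OF u that(1)] v that(2)] .
    then have "P ?S"
      using step[of S u v] Q(1,3) u v vV by blast
    \<comment> \<open>The enlarged set stays connected since any two of its nodes are joined via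
      \<open>u\<close>.\<close>
    moreover have "(i, u) \<in> ?E\<^sup>* \<and> (u, i) \<in> ?E\<^sup>*" if "i \<in> ?S" for i
    proof (cases "i = v")
      case True
      then show ?thesis using u uv vu by (auto intro: r_into_rtrancl)
    next
      case False
      then have "(i, u) \<in> (parcs T \<inter> S \<times> S)\<^sup>*" "(u, i) \<in> (parcs T \<inter> S \<times> S)\<^sup>*"
        using that Q(4) u by auto
      moreover have "(parcs T \<inter> S \<times> S)\<^sup>* \<subseteq> ?E\<^sup>*"
        by (rule rtrancl_mono) auto
      ultimately show ?thesis by blast
    qed
    then have "\<forall>i \<in> ?S. \<forall>j \<in> ?S. (i, j) \<in> ?E\<^sup>*"
      by (meson rtrancl_trans)
    ultimately have "Q ?S"
      using Q(1) vV by (simp add: Q_def)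
    then have "card ?S \<le> card S"
      using max by blast
    moreover have "finite S"
      using Q(1) T.pair_finite_verts by (rule finite_subset)
    ultimately show False
      using v by simp
  qed
  then show ?thesis
    using Q(3) by simp
qed

section \<open>Weights and decompositions\<close>

lemma finite_hyperedges:
  assumes "finite_structure \<sigma> A"
  shows "finite (hyperedges \<sigma> A)"
proof (rule finite_subset)
  show "hyperedges \<sigma> A \<subseteq> Pow (univ A)"
    using assms by (auto simp: hyperedges_def finite_structure_def)
  show "finite (Pow (univ A))"
    using assms by (simp add: finite_structure_def)
qed

lemma weight_mono:
  assumes "finite_structure \<sigma> A" and "X \<subseteq> Y"
  shows "weight \<sigma> A X \<le> weight \<sigma> A Y"
proof -
  let ?P = "\<lambda>Z k. \<exists>U. k_union \<sigma> A k U \<and> Z \<inter> \<Union>(hyperedges \<sigma> A) \<subseteq> U"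
  \<comment> \<open>All hyperedges together cover \<open>Y\<close>, so the minimum defining its
    weight is attained; a cover attaining it also covers \<open>X\<close>.\<close>
  have "?P Y (card (hyperedges \<sigma> A))"
    using finite_hyperedges[OF assms(1)] unfolding k_union_def by blast
  then have "?P Y (weight \<sigma> A Y)"
    unfolding weight_def by (rule LeastI)
  then have "?P X (weight \<sigma> A Y)"
    using assms(2) by blast
  then show ?thesis
    unfolding weight_def[of \<sigma> A X] by (rule Least_le)
qed

text \<open>The one-bag decomposition ensures that the minimum defining \<open>coverwidth\<close>
  ranges over a nonempty set.\<close>

lemma trivial_tree_decomposition:
  assumes "finite_structure \<sigma> A"
  shows "tree_decomposition \<sigma> A \<lparr>pverts = {0 :: nat}, parcs = {}\<rparr> (\<lambda>_. univ A)"
proof -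
  let ?T = "\<lparr>pverts = {0 :: nat}, parcs = {}\<rparr>"
  have "pair_graph ?T"
    by unfold_locales (auto simp: symmetric_def sym_def)
  moreover have "connected (with_proj ?T)" "connected (with_proj ?T \<restriction> {0})"
    by (auto simp: connected_def strongly_connected_def mk_symmetric_def induce_subgraph_def
        reachable_def)
  moreover have "\<not> pre_digraph.cycle (with_proj ?T) p" for p
    by (auto simp: pre_digraph.cycle_def pre_digraph.awalk_def)
  moreover have "e \<subseteq> univ A" if "e \<in> hyperedges \<sigma> A" for e
    using assms that by (auto simp: hyperedges_def finite_structure_def)
  moreover have "{i. i = (0::nat) \<and> a \<in> univ A} = {0}" if "a \<in> univ A" for a
    using that by auto
  ultimately show ?thesis
    unfolding tree_decomposition_def undirected_tree_def by auto
qed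

lemma coverwidth_attained:
  assumes "finite_structure \<sigma> A"
  obtains T :: "nat pair_pre_digraph" and X
  where "tree_decomposition \<sigma> A T X" and "decomposition_weight \<sigma> A T X = coverwidth \<sigma> A"
proof -
  let ?P = "\<lambda>w. \<exists>(T :: nat pair_pre_digraph) X.
    tree_decomposition \<sigma> A T X \<and> decomposition_weight \<sigma> A T X = w"
  have "\<exists>w. ?P w"
    using trivial_tree_decomposition[OF assms] by blast
  then have "?P (coverwidth \<sigma> A)"
    unfolding coverwidth_def by (rule LeastI_ex)
  then show ?thesis
    using that by blast
qed

section \<open>Strategies and homomorphisms\<close>

text \<open>The Duplicator always answers \<open>a\<close> with \<open>h a\<close>. The image of a
  whole tuple under \<open>h\<close> is the witness for projectivity, whatever part of the tuple
  lies in the current domain.\<close>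

lemma homomorphism_imp_winning_strategy:
  assumes "finite_structure \<sigma> A" and hom: "homomorphism \<sigma> A B h"
  shows "winning_strategy \<sigma> k A B {(\<lambda>a. Some (h a)) |` S | S. S \<subseteq> univ A}"
proof -
  define f where "f = (\<lambda>a. Some (h a))"
  have proj: "projective_homomorphism \<sigma> A B (f |` S)" if "S \<subseteq> univ A" for S
    unfolding projective_homomorphism_def
  proof (intro conjI ballI)
    show "dom (f |` S) \<subseteq> univ A" "ran (f |` S) \<subseteq> univ B"
      using that hom by (auto simp: f_def ran_def restrict_map_def homomorphism_def split: if_splits)
  next
    fix R s
    assume "R \<in> symbols \<sigma>" "s \<in> rel A R"
    then have "map h s \<in> rel B R"
      using hom by (auto simp: homomorphism_def)
    moreover have "\<forall>i < length s. s ! i \<in> dom (f |` S) \<longrightarrow> (f |` S) (s ! i) = Some (map h s ! i)"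
      by (auto simp: f_def)
    ultimately show "\<exists>t \<in> rel B R. \<forall>i < length s. s ! i \<in> dom (f |` S) \<longrightarrow>
        (f |` S) (s ! i) = Some (t ! i)"
      by blast
  qed
  have extend: "\<exists>h' \<in> {f |` S | S. S \<subseteq> univ A}. f |` S \<subseteq>\<^sub>m h' \<and> dom h' = dom (f |` S) \<union> {a}"
    if "S \<subseteq> univ A" "a \<in> univ A" for S a
  proof (rule bexI)
    show "f |` S \<subseteq>\<^sub>m f |` insert a S \<and> dom (f |` insert a S) = dom (f |` S) \<union> {a}"
      by (auto simp: f_def map_le_def)
    show "f |` insert a S \<in> {f |` S | S. S \<subseteq> univ A}"
      using that by blast
  qed
  have restr: "f |` S |` S' \<in> {f |` S | S. S \<subseteq> univ A}" if "S \<subseteq> univ A" for S S'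
  proof -
    have "f |` S |` S' = f |` (S \<inter> S')" "S \<inter> S' \<subseteq> univ A"
      using that by auto
    then show ?thesis by blast
  qed
  have "winning_strategy \<sigma> k A B {f |` S | S. S \<subseteq> univ A}"
    unfolding winning_strategy_def
  proof (intro conjI ballI allI impI)
    show "{f |` S | S. S \<subseteq> univ A} \<noteq> {}"
      by blast
  next
    fix h
    assume "h \<in> {f |` S | S. S \<subseteq> univ A}"
    then obtain S where S: "h = f |` S" "S \<subseteq> univ A"
      by blast
    show "projective_homomorphism \<sigma> A B h"
      using proj S by simp
    show "h |` S' \<in> {f |` S | S. S \<subseteq> univ A}" for S'
      unfolding S(1) using S(2) by (rule restr)
    show "\<exists>h' \<in> {f |` S | S. S \<subseteq> univ A}. h \<subseteq>\<^sub>m h' \<and> dom h' = dom h \<union> {a}"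
      if "a \<in> univ A - dom h" for a
      unfolding S(1) using extend[OF S(2)] that by blast
  qed
  then show ?thesis
    by (simp add: f_def)
qed

text \<open>The game adds one element at a time. Every intermediate domain lies in \<open>X\<close>,
  so by monotonicity its weight is at most \<open>k\<close> and the next move is always
  allowed.\<close>

lemma winning_strategy_extend:
  assumes A: "finite_structure \<sigma> A" and strat: "winning_strategy \<sigma> k A B H"
    and "X \<subseteq> univ A" and "weight \<sigma> A X \<le> k" and "h \<in> H" and "dom h \<subseteq> X"
  shows "\<exists>h' \<in> H. h \<subseteq>\<^sub>m h' \<and> dom h' = X"
proof -
  have step: "\<exists>h' \<in> H. h \<subseteq>\<^sub>m h' \<and> dom h' = dom h \<union> {a}"
    if "h \<in> H" "a \<in> univ A" "a \<notin> dom h" "weight \<sigma> A (dom h \<union> {a}) \<le> k" for h a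
    using strat that unfolding winning_strategy_def by simp
  have "finite (X - dom h)"
    using A \<open>X \<subseteq> univ A\<close> by (auto simp: finite_structure_def intro: finite_subset)
  then show ?thesis
    using \<open>h \<in> H\<close> \<open>dom h \<subseteq> X\<close>
  proof (induction "X - dom h" arbitrary: h rule: finite_psubset_induct)
    case psubset
    show ?case
    proof (cases "dom h = X")
      case True
      then show ?thesis using psubset.prems by (intro bexI[of _ h]) auto
    next
      case False
      then obtain a where a: "a \<in> X" "a \<notin> dom h"
        using psubset.prems by blast
      have "weight \<sigma> A (dom h \<union> {a}) \<le> k"
        using weight_mono[OF A, of "dom h \<union> {a}" X] a psubset.prems \<open>weight \<sigma> A X \<le> k\<close> by simp
      then obtain g where g: "g \<in> H" "h \<subseteq>\<^sub>m g" "dom g = dom h \<union> {a}"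
        using step[of h a] a psubset.prems \<open>X \<subseteq> univ A\<close> by blast
      moreover have "X - dom g \<subset> X - dom h" "dom g \<subseteq> X"
        using a g psubset.prems by auto
      ultimately obtain h' where "h' \<in> H" "g \<subseteq>\<^sub>m h'" "dom h' = X"
        using psubset.hyps(2)[of g] by metis
      then show ?thesis
        using map_le_trans g by blast
    qed
  qed
qed

text \<open>A single \<open>f\<close> instead of one assignment per bag makes the assignments
  compatible by construction. Membership in \<open>H\<close> alone would let \<open>f\<close> be
  undefined on part of a bag, hence the second conclusion.\<close>

lemma tree_decomposition_glue:
  assumes A: "finite_structure \<sigma> A" and strat: "winning_strategy \<sigma> k A B H"
    and decomp: "tree_decomposition \<sigma> A T X" and weight: "decomposition_weight \<sigma> A T X \<le> k"
  obtains f where "\<And>i. i \<in> pverts T \<Longrightarrow> f |` X i \<in> H" and "\<And>i. i \<in> pverts T \<Longrightarrow> X i \<subseteq> dom f"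
proof -
  have tree: "undirected_tree T"
    using decomp by (simp add: tree_decomposition_def)
  then have pg: "pair_graph T"
    by (simp add: undirected_tree_def)
  interpret T: pair_graph T
    by (fact pg)
  have ext: "\<exists>h' \<in> H. h \<subseteq>\<^sub>m h' \<and> dom h' = X i"
    if "i \<in> pverts T" "h \<in> H" "dom h \<subseteq> X i" for h i
  proof (rule winning_strategy_extend[OF A strat])
    show "X i \<subseteq> univ A"
      using decomp that by (auto simp: tree_decomposition_def)
    have "weight \<sigma> A (X i) \<le> decomposition_weight \<sigma> A T X"
      unfolding decomposition_weight_def using that T.pair_finite_verts by (intro Max_ge) auto
    then show "weight \<sigma> A (X i) \<le> k"
      using weight by simp
  qed (use that in auto)
  \<comment> \<open>Closure under restriction is given for subsets of the domain; intersecting with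
    the domain extends it to any set.\<close>
  have restr: "h |` S \<in> H" if "h \<in> H" for h S
  proof -
    have "h |` S = h |` (S \<inter> dom h)"
      by (auto simp: restrict_map_def fun_eq_iff)
    then show ?thesis
      using strat that unfolding winning_strategy_def by (metis inf_le2)
  qed
  let ?P = "\<lambda>S. \<exists>f. \<forall>i \<in> S. f |` X i \<in> H \<and> X i \<subseteq> dom f"
  have "?P (pverts T)"
    using tree
  proof (induction rule: undirected_tree_induct)
    case (root r)
    obtain h0 where "h0 \<in> H"
      using strat by (auto simp: winning_strategy_def)
    then have "Map.empty \<in> H"
      using restr[of h0 "{}"] by simp
    then obtain h where "h \<in> H" "dom h = X r"
      using ext[OF root, of Map.empty] by auto
    then have "h |` X r \<in> H" "X r \<subseteq> dom h"
      using restr by auto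
    then show ?case
      by blast
  next
    case (step S u v)
    then obtain f where f: "\<And>i. i \<in> S \<Longrightarrow> f |` X i \<in> H" "\<And>i. i \<in> S \<Longrightarrow> X i \<subseteq> dom f"
      by blast
    \<comment> \<open>The new bag keeps the values already chosen on its intersection with
      \<open>X u\<close>; the strategy supplies the others.\<close>
    have "f |` X u |` X v \<in> H"
      using f(1) restr \<open>u \<in> S\<close> by blast
    then obtain h where h: "h \<in> H" "f |` X u |` X v \<subseteq>\<^sub>m h" "dom h = X v"
      using ext[of v "f |` X u |` X v"] step(3) by auto
    \<comment> \<open>The nodes whose bags contain \<open>a\<close> form a connected set containing
      \<open>v\<close> and \<open>i\<close>, hence also \<open>u\<close>. So \<open>a\<close> lies
      in \<open>X u\<close> and its value was inherited from \<open>f\<close>.\<close>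
    have agree: "h a = f a" if "i \<in> S" "a \<in> X i" "a \<in> X v" for i a
    proof -
      let ?C = "{j \<in> pverts T. a \<in> X j}"
      have "a \<in> univ A"
        using decomp that step(1) by (auto simp: tree_decomposition_def)
      then have "connected (with_proj T \<restriction> ?C)"
        using decomp by (auto simp: tree_decomposition_def)
      then have "(v, i) \<in> (parcs T \<inter> ?C \<times> ?C)\<^sup>*"
        using connected_restrict_rtrancl[OF pair_graph_sym_parcs[OF pg], of ?C v i] that step(1,3)
        by auto
      then have "u \<in> ?C"
        using step(4)[of i ?C] \<open>i \<in> S\<close> by simp
      then have "a \<in> dom (f |` X u |` X v)" "(f |` X u |` X v) a = f a"
        using f(2) \<open>u \<in> S\<close> \<open>a \<in> X v\<close> by auto
      then show ?thesis
        using h(2) by (metis map_le_def)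
    qed
    \<comment> \<open>In \<open>f ++ h\<close> the right operand takes precedence, and its domain is
      exactly \<open>X v\<close>. By \<open>agree\<close> this overwriting changes nothing on the
      explored bags.\<close>
    have "((f ++ h) |` X v) a = h a" for a
      using h(3) domIff[of a h] by (cases "a \<in> X v") (simp_all add: map_add_dom_app_simps(1))
    then have "(f ++ h) |` X v = h" ..
    moreover have "(f ++ h) |` X i = f |` X i" if "i \<in> S" for i
    proof
      fix a
      show "((f ++ h) |` X i) a = (f |` X i) a"
      proof (cases "a \<in> X v")
        case True
        then have "(f ++ h) a = h a"
          using h(3) by (simp add: map_add_dom_app_simps(1))
        then show ?thesis
          using agree[OF that _ True] by (simp add: restrict_map_def)
      next
        case False
        then have "(f ++ h) a = f a"
          using h(3) by (simp add: map_add_dom_app_simps(3))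
        then show ?thesis
          by (simp add: restrict_map_def)
      qed
    qed
    ultimately have "\<forall>i \<in> insert v S. (f ++ h) |` X i \<in> H \<and> X i \<subseteq> dom (f ++ h)"
      using f h(1,3) by (simp add: le_supI2)
    then show ?case by (rule exI[of _ "f ++ h"])
  qed
  then show ?thesis
    using that by blast
qed

text \<open>Each tuple of \<open>A\<close> lies within one bag, where the glued \<open>f\<close> is
  total and projective, so the tuple of \<open>B\<close> matching it is its full image.\<close>

lemma winning_strategy_imp_homomorphism:
  assumes A: "finite_structure \<sigma> A" and B: "finite_structure \<sigma> B"
    and strat: "winning_strategy \<sigma> k A B H"
    and decomp: "tree_decomposition \<sigma> A T X" and weight: "decomposition_weight \<sigma> A T X \<le> k"
  shows "\<exists>h. homomorphism \<sigma> A B h"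
proof -
  obtain f where f: "\<And>i. i \<in> pverts T \<Longrightarrow> f |` X i \<in> H" "\<And>i. i \<in> pverts T \<Longrightarrow> X i \<subseteq> dom f"
    using tree_decomposition_glue[OF A strat decomp weight] by blast
  have proj: "projective_homomorphism \<sigma> A B (f |` X i)" if "i \<in> pverts T" for i
    using strat f(1)[OF that] by (simp add: winning_strategy_def)
  have "the (f a) \<in> univ B" if "a \<in> univ A" for a
  proof -
    have "a \<in> (\<Union>i \<in> pverts T. X i)"
      using decomp that by (simp add: tree_decomposition_def)
    then obtain i where i: "i \<in> pverts T" "a \<in> X i"
      by blast
    then have "(f |` X i) a = Some (the (f a))"
      using f(2)[OF i(1)] by (auto simp: restrict_map_def)
    then have "the (f a) \<in> ran (f |` X i)"
      by (rule ranI)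
    then show ?thesis
      using proj[OF i(1)] by (auto simp: projective_homomorphism_def)
  qed
  moreover have "map (\<lambda>a. the (f a)) s \<in> rel B R" if R: "R \<in> symbols \<sigma>" and s: "s \<in> rel A R" for R s
  proof -
    have "set s \<in> hyperedges \<sigma> A"
      using R s by (auto simp: hyperedges_def)
    then have "\<exists>i \<in> pverts T. set s \<subseteq> X i"
      using decomp by (simp add: tree_decomposition_def)
    then obtain i where i: "i \<in> pverts T" "set s \<subseteq> X i"
      by blast
    have "\<forall>s \<in> rel A R. \<exists>t \<in> rel B R.
        \<forall>n < length s. s ! n \<in> dom (f |` X i) \<longrightarrow> (f |` X i) (s ! n) = Some (t ! n)"
      using proj[OF i(1)] R unfolding projective_homomorphism_def by (elim conjE) (rule bspec)
    then obtain t where t: "t \<in> rel B R"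
      and eq: "\<And>n. n < length s \<Longrightarrow> s ! n \<in> dom (f |` X i) \<Longrightarrow> (f |` X i) (s ! n) = Some (t ! n)"
      using s by meson
    have "f (s ! n) = Some (t ! n)" if "n < length s" for n
    proof -
      have "s ! n \<in> X i"
        using i(2) that by auto
      then show ?thesis
        using eq[OF that] f(2)[OF i(1)] by auto
    qed
    \<comment> \<open>Projectivity constrains \<open>t\<close> only at the positions of
      \<open>s\<close>; the common arity excludes surplus entries.\<close>
    moreover have "length s = arity \<sigma> R" "length t = arity \<sigma> R"
      using A B R s t by (auto simp: finite_structure_def)
    ultimately have "map (\<lambda>a. the (f a)) s = t"
      by (intro nth_equalityI) auto
    then show ?thesis
      using t by simp
  qed
  ultimately have "homomorphism \<sigma> A B (\<lambda>a. the (f a))"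
    by (simp add: homomorphism_def Pi_iff)
  then show ?thesis by (rule exI[of _ "\<lambda>a. the (f a)"])
qed

theorem theorem3:
  fixes \<sigma> :: "'r signature"
    and A :: "('r, 'a) rel_structure"
    and B :: "('r, 'b) rel_structure"
    and k :: nat
  assumes "finite (symbols \<sigma>)"
    and "finite_structure \<sigma> A"
    and "finite_structure \<sigma> B"
    and "k \<ge> 1"
    and "coverwidth \<sigma> A \<le> k"
  shows "(\<exists>H. winning_strategy \<sigma> k A B H) \<longleftrightarrow> (\<exists>h. homomorphism \<sigma> A B h)"
proof
  assume "\<exists>H. winning_strategy \<sigma> k A B H"
  moreover obtain T :: "nat pair_pre_digraph" and X
    where "tree_decomposition \<sigma> A T X" and "decomposition_weight \<sigma> A T X = coverwidth \<sigma> A"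
    using coverwidth_attained[OF assms(2)] .
  ultimately show "\<exists>h. homomorphism \<sigma> A B h"
    using winning_strategy_imp_homomorphism[OF assms(2,3)] assms(5) by metis
next
  assume "\<exists>h. homomorphism \<sigma> A B h"
  then show "\<exists>H. winning_strategy \<sigma> k A B H"
    using homomorphism_imp_winning_strategy[OF assms(2)] by blast
qed

end
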